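(* Let $n\ge 2$ and let $u\in S_n$. Then $$\partial_u\mathfrak{S}_{w_0^n}=\sum_{\overrightarrow{T_{n-1}},\ldots,\overrightarrow{T_1}}X^{u}_{\overrightarrow{T_{n-1}}}\,X^{u(\overrightarrow{T_{n-1}})}_{\overrightarrow{T_{n-2}}}\cdots X^{u(\overrightarrow{T_{n-1}},\ldots,\overrightarrow{T_2})}_{\overrightarrow{T_1}},$$ where the summation is over all sequences $\overrightarrow{T_{n-1}},\ldots,\overrightarrow{T_1}$ such that $u(\overrightarrow{T_{n-1}},\ldots,\overrightarrow{T_l})$ is defined for every $1\le l\le n-1$.
   Context: $\mathbb{N}$ is the set of nonnegative integers. For integers $i,j$: $[i,j]=\{i,\ldots,j\}$ if $i\le j$ and $\emptyset$ otherwise; $X[i,j]=x_ix_{i+1}\cdots x_j$ if $i\le j$ and $1$ otherwise; $P(i>j)=1$ if $i>j$ and $0$ otherwise. Symmetric group and normal forms. $S_n$ is generated by $s_1,\ldots,s_{n-1}$, $s_i$ being the adjacent transposition $(i,i+1)$. For $j\le i$ let $s_{i,j}$ be the word $s_is_{i-1}\cdots s_j$, and $s_{i,j}=1$ (empty word) if $j>i$. Every element of $S_n$ is represented by exactly one word $s_{1,i_1}s_{2,i_2}\cdots s_{n-1,i_{n-1}}$ with $1\le i_j\le j+1$, called its normal form; elements of $S_n$ are always written in normal form ($S_1$ consists of $1$ only). For a word $w$, $[w]$ denotes the normal form of the element it represents. A word is reduced if no shorter word represents the same element. $\frac{s_{i,j}}{s_k}$ denotes the word $s_{i,j}$ with the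 letter $s_k$ deleted if $j\le k\le i$; it is $s_{i,j}$ if $j\le i<k$ or $k<j\le i$; and it is $1$ if $i<j$. Divided differences. $s_if$ is the result of interchanging $x_i,x_{i+1}$ in the polynomial $f$, $\partial_i(f)=\frac{f-s_if}{x_i-x_{i+1}}$; for a word $u=s_{a_1}\cdots s_{a_p}$, $\partial_u=\partial_{a_1}\cdots\partial_{a_p}$ (identity for the empty word). $w_0^n=s_{1,1}s_{2,1}\cdots s_{n-1,1}$ and $\mathfrak{S}_{w_0^n}=x_1^{n-1}x_2^{n-2}\cdots x_{n-2}^2x_{n-1}$. (So $\partial_u\mathfrak{S}_{w_0^n}$ is the Schubert polynomial of $w_0^nu^{-1}$.) The numbers $q^v_{r,j}$ and $m^v_r$. Let $N\ge2$, $v=s_{1,i_1}\cdots s_{N-1,i_{N-1}}\in S_N$ in normal form and $1\le r\le N-1$. Put $q^v_{r,0}=r$ and $M^v_{r,1}=\{j\in\mathbb{N}\mid 1\le j<q^v_{r,0},\ i_r-1\in[i_j,j]\}$. Inductively, if $M^v_{r,l}\ne\emptyset$ put $q^v_{r,l}=\max M^v_{r,l}$ and $M^v_{r,l+1}=\{j\in\mathbb{N}\mid 1\le j<q^v_{r,l},\ i_r-(l+1)\in[i_j,j]\}$; if $M^v_{r,l}=\emptyset$ put $m^v_r=l-1$ and stop. One step. For $N\ge2$ and $v=s_{1,i_1}\cdots s_{N-1,i_{N-1}}\in S_N$ in normal form write $m=m^v_{N-1}$, $q_j=q^v_{N-1,j}$. $\overrightarrow{T_{N-1}}$ denotes any vector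 $(t_m,\ldots,t_2,t_1,0)$ with $t_j\in\mathbb{N}$ and $i_{N-1}-j\le t_j\le q_j+1$ for $1\le j\le m$ (so $\overrightarrow{T_{N-1}}=(0)$ if $m=0$). Consider the word obtained from $s_{1,i_1}s_{2,i_2}\cdots s_{N-2,i_{N-2}}$ by replacing, for every $1\le j\le m$, the factor $s_{q_j,i_{q_j}}$ by $\frac{s_{q_j,i_{q_j}}}{s_{t_j}}$. If this word is reduced, $v(\overrightarrow{T_{N-1}})\in S_{N-1}$ is its normal form; otherwise $v(\overrightarrow{T_{N-1}})$ is undefined. When it is defined, put $$X^v_{\overrightarrow{T_{N-1}}}=X[1,i_{N-1}-m-1]\prod_{1\le j\le m}x_{1+q_j}^{P(t_j>q_j)}$$ (the product being $1$ if $m=0$). Iteration. Given $u\in S_n$, $u(\overrightarrow{T_{n-1}})\in S_{n-1}$ is given by the one-step definition with $N=n$. Inductively, if $v=u(\overrightarrow{T_{n-1}},\ldots,\overrightarrow{T_{n-l}})\in S_{n-l}$ is defined, then $\overrightarrow{T_{n-l-1}}$ ranges over the vectors allowed by the one-step definition for $v$ with $N=n-l$, $u(\overrightarrow{T_{n-1}},\ldots,\overrightarrow{T_{n-l-1}})=v(\overrightarrow{T_{n-l-1}})$ and $X^{u(\overrightarrow{T_{n-1}},\ldots,\overrightarrow{T_{n-l}})}_{\overrightarrow{T_{n-l-1}}}=X^v_{\overrightarrow{T_{n-l-1}}}$; if $u(\overrightarrow{T_{n-1}},\ldots,\overrightarrow{T_{n-l}})$ is undefined, then so is $u(\overrightarrow{T_{n-1}},\ldots,\overrightarrow{T_{n-l-1}})$.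 *)

theory Defs
  imports "HOL-Library.Poly_Mapping" "HOL-Library.FuncSet" "HOL-Combinatorics.Permutations"
begin

section \<open>Polynomials and divided differences\<close>

text \<open>Monomials are finitely supported exponent functions, so this is the polynomial ring over the
  integers in variables indexed by the naturals; variable \<open>0\<close> is never used.\<close>

type_synonym poly = "(nat \<Rightarrow>\<^sub>0 nat) \<Rightarrow>\<^sub>0 int"

definition Var :: "nat \<Rightarrow> poly" where
  "Var i = Poly_Mapping.single (Poly_Mapping.single i 1) 1"

text \<open>\<open>map_key g f\<close> has coefficient function \<open>lookup f \<circ> g\<close> (for injective \<open>g\<close>). The inner use
  interchanges the exponents at \<open>i\<close> and \<open>i + 1\<close>; as this is an involution on monomials, the outer
  use applies it to every monomial of the polynomial.\<close>

definition swap_vars :: "nat \<Rightarrow> poly \<Rightarrow> poly" where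
  "swap_vars i f = Poly_Mapping.map_key (Poly_Mapping.map_key (transpose i (i + 1))) f"

lemma swap_exps_involution:
  "Poly_Mapping.map_key (transpose i (i + 1)) (Poly_Mapping.map_key (transpose i (i + 1)) m) = m"
  for m :: "nat \<Rightarrow>\<^sub>0 nat"
  by (simp add: map_key_compose inj_transpose map_key_id[unfolded id_def[symmetric]])

lemma lookup_swap_vars:
  "Poly_Mapping.lookup (swap_vars i f) m
    = Poly_Mapping.lookup f (Poly_Mapping.map_key (transpose i (i + 1)) m)"
proof -
  have "inj (Poly_Mapping.map_key (transpose i (i + 1)) :: (nat \<Rightarrow>\<^sub>0 nat) \<Rightarrow> _)"
    by (rule inj_on_inverseI[where g = "Poly_Mapping.map_key (transpose i (i + 1))"])
      (rule swap_exps_involution)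
  then show ?thesis
    unfolding swap_vars_def by (simp add: map_key.rep_eq)
qed

text \<open>The quotient is unique because polynomials form an integral domain, and exists because
  \<open>f - swap_vars i f\<close> vanishes on identifying the two variables.\<close>

definition ddiff :: "nat \<Rightarrow> poly \<Rightarrow> poly" where
  "ddiff i f = (THE g. (Var i - Var (i + 1)) * g = f - swap_vars i f)"

definition ddiff_word :: "nat list \<Rightarrow> poly \<Rightarrow> poly" where
  "ddiff_word w f = foldr ddiff w f"

definition schubert_w0 :: "nat \<Rightarrow> poly" where
  "schubert_w0 n = (\<Prod>i = 1..n - 1. Var i ^ (n - i))"

section \<open>Words and normal forms\<close>

text \<open>A word in the letters \<open>s\<^sub>1, s\<^sub>2, \<dots>\<close> is the list of its indices. Elements of the symmetric group
  on \<open>n\<close> letters are the permutations \<open>p\<close> with \<open>p permutes {1..n}\<close>. Composing in the opposite order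
  would replace every element by its inverse, and so would not affect which words represent the
  same element.\<close>

definition perm_of :: "nat list \<Rightarrow> nat \<Rightarrow> nat" where
  "perm_of w = foldr (\<lambda>i p. transpose i (i + 1) \<circ> p) w id"

definition s_word :: "nat \<Rightarrow> nat \<Rightarrow> nat list" where
  "s_word i j = rev [j..<i + 1]"

text \<open>The letters of \<open>s_word i j\<close> are distinct, and \<open>remove1 k\<close> does nothing if \<open>k\<close> does not occur.\<close>

definition s_word_del :: "nat \<Rightarrow> nat \<Rightarrow> nat \<Rightarrow> nat list" where
  "s_word_del i j k = remove1 k (s_word i j)"

text \<open>A normal form in the symmetric group on \<open>n\<close> letters is given by its indices
  \<open>i 1, \<dots>, i (n - 1)\<close>.\<close>

definition nf_indices :: "nat \<Rightarrow> (nat \<Rightarrow> nat) set" where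
  "nf_indices n = (\<Pi>\<^sub>E j\<in>{1..n - 1}. {1..j + 1})"

definition nf_word :: "nat \<Rightarrow> (nat \<Rightarrow> nat) \<Rightarrow> nat list" where
  "nf_word n i = concat (map (\<lambda>j. s_word j (i j)) [1..<n])"

definition nf :: "nat \<Rightarrow> (nat \<Rightarrow> nat) \<Rightarrow> (nat \<Rightarrow> nat)" where
  "nf n p = (THE i. i \<in> nf_indices n \<and> perm_of (nf_word n i) = p)"

definition reduced :: "nat \<Rightarrow> nat list \<Rightarrow> bool" where
  "reduced n w \<longleftrightarrow>
    (\<forall>w'. set w' \<subseteq> {1..<n} \<and> perm_of w' = perm_of w \<longrightarrow> length w \<le> length w')"

section \<open>The numbers \<open>q\<close> and \<open>m\<close>\<close>

text \<open>Here \<open>i\<close> are the indices of a normal form, so \<open>i j \<ge> 1\<close>. Hence, if the truncated difference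
  \<open>i r - l\<close> is \<open>0\<close>, it lies in no interval \<open>{i j..j}\<close>, just like the integer difference.\<close>

definition M_set :: "(nat \<Rightarrow> nat) \<Rightarrow> nat \<Rightarrow> nat \<Rightarrow> nat \<Rightarrow> nat set" where
  "M_set i r l q = {j. 1 \<le> j \<and> j < q \<and> i r - l \<in> {i j..j}}"

text \<open>\<open>q_num i r l\<close> is meaningful for \<open>l \<le> m_num i r\<close> only; beyond, it is \<open>Max {}\<close> or depends on it.\<close>

primrec q_num :: "(nat \<Rightarrow> nat) \<Rightarrow> nat \<Rightarrow> nat \<Rightarrow> nat" where
  "q_num i r 0 = r"
| "q_num i r (Suc l) = Max (M_set i r (Suc l) (q_num i r l))"

definition m_num :: "(nat \<Rightarrow> nat) \<Rightarrow> nat \<Rightarrow> nat" where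
  "m_num i r = (LEAST l. M_set i r (Suc l) (q_num i r l) = {})"

section \<open>One step\<close>

text \<open>A vector \<open>(t\<^sub>m, \<dots>, t\<^sub>1, 0)\<close> is a function on \<open>{0..m}\<close> with value \<open>0\<close> at \<open>0\<close>. The differences
  \<open>i (N - 1) - j\<close> below are never truncated: since \<open>j \<le> m\<close>, \<open>i (N - 1) - j\<close> lies in some
  \<open>{i k..k}\<close>, so it is at least \<open>1\<close>.\<close>

definition T_vectors :: "nat \<Rightarrow> (nat \<Rightarrow> nat) \<Rightarrow> (nat \<Rightarrow> nat) set" where
  "T_vectors N v = (let i = nf N v; m = m_num i (N - 1); q = q_num i (N - 1) in
    {t \<in> extensional {0..m}. t 0 = 0 \<and> (\<forall>j\<in>{1..m}. i (N - 1) - j \<le> t j \<and> t j \<le> q j + 1)})"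

text \<open>The numbers \<open>q 1 > \<dots> > q m\<close> are distinct, so \<open>inv_into\<close> recovers the \<open>j\<close> with \<open>q j = k\<close>.\<close>

definition step_word :: "nat \<Rightarrow> (nat \<Rightarrow> nat) \<Rightarrow> (nat \<Rightarrow> nat) \<Rightarrow> nat list" where
  "step_word N v t = (let i = nf N v; m = m_num i (N - 1); q = q_num i (N - 1) in
    concat (map (\<lambda>k. if k \<in> q ` {1..m} then s_word_del k (i k) (t (inv_into {1..m} q k))
                     else s_word k (i k)) [1..<N - 1]))"

definition step :: "nat \<Rightarrow> (nat \<Rightarrow> nat) \<Rightarrow> (nat \<Rightarrow> nat) \<Rightarrow> (nat \<Rightarrow> nat) option" where
  "step N v t =
    (if reduced (N - 1) (step_word N v t) then Some (perm_of (step_word N v t)) else None)"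

definition X_mon :: "nat \<Rightarrow> (nat \<Rightarrow> nat) \<Rightarrow> (nat \<Rightarrow> nat) \<Rightarrow> poly" where
  "X_mon N v t = (let i = nf N v; m = m_num i (N - 1); q = q_num i (N - 1) in
    (\<Prod>k = 1..i (N - 1) - m - 1. Var k) * (\<Prod>j = 1..m. Var (1 + q j) ^ of_bool (t j > q j)))"

section \<open>Iteration\<close>

text \<open>\<open>steps n u [T\<^sub>n\<^sub>-\<^sub>1, \<dots>, T\<^sub>l]\<close> is the element of the symmetric group on \<open>l\<close> letters obtained by
  the successive steps, or \<open>None\<close> if some vector is not allowed or some step is undefined.\<close>

primrec steps :: "nat \<Rightarrow> (nat \<Rightarrow> nat) \<Rightarrow> (nat \<Rightarrow> nat) list \<Rightarrow> (nat \<Rightarrow> nat) option" where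
  "steps n u [] = Some u"
| "steps n u (t # ts) =
    (if t \<in> T_vectors n u
     then (case step n u t of None \<Rightarrow> None | Some v \<Rightarrow> steps (n - 1) v ts)
     else None)"

text \<open>In a list \<open>[T\<^sub>n\<^sub>-\<^sub>1, \<dots>, T\<^sub>1]\<close> the vector \<open>T\<^sub>l\<close> has position \<open>n - 1 - l\<close>, and
  \<open>[T\<^sub>n\<^sub>-\<^sub>1, \<dots>, T\<^sub>l]\<close> consists of the first \<open>n - l\<close> entries.\<close>

definition T_sequences :: "nat \<Rightarrow> (nat \<Rightarrow> nat) \<Rightarrow> (nat \<Rightarrow> nat) list set" where
  "T_sequences n u =
    {Ts. length Ts = n - 1 \<and> (\<forall>l\<in>{1..n - 1}. steps n u (take (n - l) Ts) \<noteq> None)}"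

end

theory Submission
  imports Defs
begin

text \<open>Write \<open>u = u' s\<^sub>n\<^sub>-\<^sub>1\<dots>s\<^sub>a\<close> with \<open>u'\<close> in the symmetric group on \<open>n - 1\<close> letters. The last factor turns
  \<open>\<SS>\<close> of the longest element into \<open>x\<^sub>1\<dots>x\<^sub>a\<^sub>-\<^sub>1\<close> times the same polynomial for \<open>n - 1\<close>. Moving
  \<open>\<partial>\<^sub>u\<^sub>'\<close> past \<open>x\<^sub>1\<dots>x\<^sub>a\<^sub>-\<^sub>1\<close> by the Leibniz rule, only a letter \<open>s\<^sub>k\<close> whose index is that of the last variable of
  the current product interacts with it: either this letter is deleted and \<open>x\<^sub>k\<close> disappears, or it is kept and
  \<open>x\<^sub>k\<close> becomes \<open>x\<^sub>k\<^sub>+\<^sub>1\<close>, which may meet the next letter of the same factor. The numbers \<open>q\<close> are the factors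
  where this happens, and \<open>t\<close> is the letter deleted (none if \<open>t > q\<close>). The divided difference of the
  resulting word vanishes unless the word is reduced, and then depends on its permutation only.\<close>

section \<open>Divided differences\<close>

abbreviation exp_swap :: "nat \<Rightarrow> (nat \<Rightarrow>\<^sub>0 nat) \<Rightarrow> (nat \<Rightarrow>\<^sub>0 nat)" where
  "exp_swap i \<equiv> Poly_Mapping.map_key (transpose i (Suc i))"

lemma exp_swap_exp_swap_same: "exp_swap i (exp_swap i m) = m"
  using swap_exps_involution[of i m] by simp

lemma lookup_swap_vars_Suc:
  "Poly_Mapping.lookup (swap_vars i f) m = Poly_Mapping.lookup f (exp_swap i m)"
  by (simp add: lookup_swap_vars)

lemma exp_swap_add: "exp_swap i (m + m') = exp_swap i m + exp_swap i m'"
  by (rule map_key_plus) (simp add: inj_transpose)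

lemma swap_vars_add: "swap_vars i (f + g) = swap_vars i f + swap_vars i g"
  by (rule poly_mapping_eqI) (simp add: lookup_swap_vars_Suc lookup_add)

lemma swap_vars_diff: "swap_vars i (f - g) = swap_vars i f - swap_vars i g"
  by (rule poly_mapping_eqI) (simp add: lookup_swap_vars_Suc lookup_minus)

lemma swap_vars_single:
  "swap_vars i (Poly_Mapping.single m c) = Poly_Mapping.single (exp_swap i m) c"
proof (rule poly_mapping_eqI)
  fix k
  have "m = exp_swap i k \<longleftrightarrow> exp_swap i m = k"
    using exp_swap_exp_swap_same by metis
  then show "Poly_Mapping.lookup (swap_vars i (Poly_Mapping.single m c)) k =
      Poly_Mapping.lookup (Poly_Mapping.single (exp_swap i m) c) k"
    by (simp add: lookup_swap_vars_Suc lookup_single)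
qed

lemma swap_vars_0 [simp]: "swap_vars i 0 = 0"
  by (rule poly_mapping_eqI) (simp add: lookup_swap_vars_Suc)

lemma swap_vars_1 [simp]: "swap_vars i 1 = 1"
  using swap_vars_single[of i 0 1] by simp

lemma poly_induct [case_names zero monomial diff]:
  fixes f :: poly
  assumes "P 0" "\<And>m. P (frag_of m)" "\<And>f g. P f \<Longrightarrow> P g \<Longrightarrow> P (f - g)"
  shows "P f"
  using frag_induction[of f UNIV P] assms by blast

lemma swap_vars_mult: "swap_vars i (f * g) = swap_vars i f * swap_vars i g"
proof (induction f rule: poly_induct)
  case (monomial m)
  show ?case
    by (induction g rule: poly_induct)
      (simp_all add: swap_vars_single mult_single exp_swap_add right_diff_distrib swap_vars_diff)
qed (simp_all add: left_diff_distrib swap_vars_diff)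

lemma swap_vars_prod: "swap_vars i (\<Prod>k\<in>A. f k) = (\<Prod>k\<in>A. swap_vars i (f k))"
  by (induction A rule: infinite_finite_induct) (simp_all add: swap_vars_mult)

lemma swap_vars_power: "swap_vars i (f ^ k) = swap_vars i f ^ k"
  by (induction k) (simp_all add: swap_vars_mult)

lemma swap_vars_Var: "swap_vars i (Var k) = Var (transpose i (Suc i) k)"
proof -
  have "exp_swap i (Poly_Mapping.single k 1) = Poly_Mapping.single (transpose i (Suc i) k) (1::nat)"
    using map_key_single[of "transpose i (Suc i)" "transpose i (Suc i) k" "1::nat"]
    by (simp add: inj_transpose)
  then show ?thesis by (simp add: Var_def swap_vars_single)
qed

lemma swap_vars_Var_other: "k \<noteq> i \<Longrightarrow> k \<noteq> Suc i \<Longrightarrow> swap_vars i (Var k) = Var k"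
  by (simp add: swap_vars_Var)

lemma swap_vars_involution [simp]: "swap_vars i (swap_vars i f) = f"
  by (rule poly_mapping_eqI) (simp add: lookup_swap_vars_Suc exp_swap_exp_swap_same)

lemma exp_swap_exp_swap:
  "exp_swap i (exp_swap j m)
    = Poly_Mapping.map_key (transpose j (Suc j) \<circ> transpose i (Suc i)) m"
  by (simp add: map_key_compose inj_transpose)

lemma swap_vars_commute:
  assumes "Suc i < j"
  shows "swap_vars i (swap_vars j f) = swap_vars j (swap_vars i f)"
proof -
  have "transpose j (Suc j) \<circ> transpose i (Suc i) = transpose i (Suc i) \<circ> transpose j (Suc j)"
    using assms by (auto simp: fun_eq_iff transpose_def)
  then have "exp_swap i (exp_swap j m) = exp_swap j (exp_swap i m)" for m
    using exp_swap_exp_swap by metis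
  then show ?thesis
    by (intro poly_mapping_eqI) (simp add: lookup_swap_vars_Suc)
qed

lemma swap_vars_braid:
  "swap_vars i (swap_vars (Suc i) (swap_vars i f))
    = swap_vars (Suc i) (swap_vars i (swap_vars (Suc i) f))"
proof -
  let ?s = "transpose i (Suc i)" and ?t = "transpose (Suc i) (Suc (Suc i))"
  have *: "?s \<circ> ?t \<circ> ?s = ?t \<circ> ?s \<circ> ?t"
    by (auto simp: fun_eq_iff transpose_def)
  have "exp_swap i (exp_swap (Suc i) (exp_swap i m)) =
      exp_swap (Suc i) (exp_swap i (exp_swap (Suc i) m))" for m
    using * map_key_compose[of "?s \<circ> ?t" ?s] map_key_compose[of "?t \<circ> ?s" ?t]
    by (simp add: map_key_compose inj_transpose inj_compose o_assoc)
  then show ?thesis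
    by (intro poly_mapping_eqI) (simp add: lookup_swap_vars_Suc)
qed

lemma Var_eq_iff [simp]: "Var i = Var j \<longleftrightarrow> i = j"
proof
  assume "Var i = Var j"
  then have "Poly_Mapping.single i (1::nat) = Poly_Mapping.single j 1"
    unfolding Var_def by (simp add: frag_of_eq)
  then have "Poly_Mapping.lookup (Poly_Mapping.single i (1::nat)) i =
      Poly_Mapping.lookup (Poly_Mapping.single j 1) i"
    by simp
  then show "i = j" by (auto simp: lookup_single when_def split: if_splits)
qed simp

section \<open>Existence of the quotient and the twisted Leibniz rule\<close>

definition ddiffable :: "nat \<Rightarrow> poly \<Rightarrow> bool" where
  "ddiffable i f \<longleftrightarrow> (\<exists>g. (Var i - Var (Suc i)) * g = f - swap_vars i f)"

lemma ddiffable_Var: "ddiffable i (Var k)"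
proof (cases "k = i \<or> k = Suc i")
  case True
  then show ?thesis
  proof
    assume "k = i"
    then show ?thesis unfolding ddiffable_def
      by (intro exI[of _ 1]) (simp add: swap_vars_Var)
  next
    assume "k = Suc i"
    then show ?thesis unfolding ddiffable_def
      by (intro exI[of _ "-1"]) (simp add: swap_vars_Var)
  qed
next
  case False
  then show ?thesis unfolding ddiffable_def
    by (intro exI[of _ 0]) (simp add: swap_vars_Var)
qed

lemma ddiffable_diff:
  assumes "ddiffable i f" "ddiffable i g" shows "ddiffable i (f - g)"
proof -
  from assms obtain f' g' where "(Var i - Var (Suc i)) * f' = f - swap_vars i f"
    "(Var i - Var (Suc i)) * g' = g - swap_vars i g"
    unfolding ddiffable_def by blast
  then have "(Var i - Var (Suc i)) * (f' - g') = (f - g) - swap_vars i (f - g)"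
    by (simp add: swap_vars_diff right_diff_distrib)
  then show ?thesis unfolding ddiffable_def by blast
qed

lemma ddiffable_mult:
  assumes "ddiffable i f" "ddiffable i g" shows "ddiffable i (f * g)"
proof -
  from assms obtain f' g' where "(Var i - Var (Suc i)) * f' = f - swap_vars i f"
    "(Var i - Var (Suc i)) * g' = g - swap_vars i g"
    unfolding ddiffable_def by blast
  \<comment> \<open>The difference f g - s(f) s(g) is telescoped through the mixed term s(f) g. The
    resulting witness f' g + s(f) g' is the twisted Leibniz rule of
    \<open>ddiff_mult\<close>.\<close>
  then have "(Var i - Var (Suc i)) * f' * g + swap_vars i f * ((Var i - Var (Suc i)) * g') =
      (f - swap_vars i f) * g + swap_vars i f * (g - swap_vars i g)"
    by simp
  then have "(Var i - Var (Suc i)) * (f' * g + swap_vars i f * g') = f * g - swap_vars i (f * g)"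
    by (simp add: swap_vars_mult algebra_simps)
  then show ?thesis unfolding ddiffable_def by blast
qed

lemma ddiffable_1: "ddiffable i 1"
  unfolding ddiffable_def by (intro exI[of _ 0]) simp

lemma ddiffable_power: "ddiffable i f \<Longrightarrow> ddiffable i (f ^ k)"
  by (induction k) (simp_all add: ddiffable_1 ddiffable_mult)

lemma Var_power: "Var k ^ a = Poly_Mapping.single (Poly_Mapping.single k a) 1"
  by (induction a) (simp_all add: Var_def mult_single single_add[symmetric])

lemma ddiffable: "ddiffable i f"
proof (induction f rule: poly_induct)
  case (monomial m)
  show ?case
  \<comment> \<open>Each update introduces a variable that does not yet occur, so the monomial grows
    by a factor \<open>Var k ^ a\<close> and closure under products applies.\<close>
  proof (induction m rule: update_induct)
    case const
    then show ?case by (simp add: ddiffable_1)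
  next
    case (update m k a)
    then have "Poly_Mapping.update k a m = Poly_Mapping.single k a + m"
      by (intro poly_mapping_eqI)
        (auto simp: lookup_update lookup_add lookup_single in_keys_iff when_def)
    then have "frag_of (Poly_Mapping.update k a m) = Var k ^ a * frag_of m"
      by (simp add: Var_power mult_single)
    then show ?case
      using update by (simp add: ddiffable_mult ddiffable_power ddiffable_Var)
  qed
next
  case zero
  show ?case unfolding ddiffable_def by (intro exI[of _ 0]) simp
qed (rule ddiffable_diff)

lemma ddiff_eqI:
  assumes "(Var i - Var (Suc i)) * g = f - swap_vars i f"
  shows "ddiff i f = g"
  unfolding ddiff_def
proof (rule the_equality)
  fix g' assume "(Var i - Var (i + 1)) * g' = f - swap_vars i f"
  with assms have "(Var i - Var (Suc i)) * g' = (Var i - Var (Suc i)) * g" by simp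
  then show "g' = g" by simp
qed (use assms in simp)

lemma mult_ddiff: "(Var i - Var (Suc i)) * ddiff i f = f - swap_vars i f"
  using ddiffable[of i f] ddiff_eqI unfolding ddiffable_def by blast

text \<open>Numerator and denominator both change sign under the transposition, so the quotient is
  symmetric.\<close>

lemma swap_vars_ddiff [simp]: "swap_vars i (ddiff i f) = ddiff i f"
proof -
  have "swap_vars i ((Var i - Var (Suc i)) * ddiff i f) = swap_vars i (f - swap_vars i f)"
    by (simp add: mult_ddiff)
  then have "(Var (Suc i) - Var i) * swap_vars i (ddiff i f) = swap_vars i f - f"
    by (simp add: swap_vars_mult swap_vars_diff swap_vars_Var)
  then have "(Var i - Var (Suc i)) * swap_vars i (ddiff i f) = f - swap_vars i f"
    by (simp add: algebra_simps)
  then show ?thesis using ddiff_eqI by metis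
qed

lemma ddiff_sym: "swap_vars i f = f \<Longrightarrow> ddiff i f = 0"
  by (rule ddiff_eqI) simp

lemma ddiff_ddiff: "ddiff i (ddiff i f) = 0"
  by (simp add: ddiff_sym)

lemma ddiff_0 [simp]: "ddiff i 0 = 0"
  by (simp add: ddiff_sym)

lemma ddiff_add: "ddiff i (f + g) = ddiff i f + ddiff i g"
  by (rule ddiff_eqI) (simp add: distrib_left mult_ddiff swap_vars_add)

lemma ddiff_mult: "ddiff i (f * g) = ddiff i f * g + swap_vars i f * ddiff i g"
proof (rule ddiff_eqI)
  have "(Var i - Var (Suc i)) * (ddiff i f * g + swap_vars i f * ddiff i g) =
      ((Var i - Var (Suc i)) * ddiff i f) * g + swap_vars i f * ((Var i - Var (Suc i)) * ddiff i g)"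
    by (simp only: distrib_left mult.assoc mult.left_commute)
  also have "\<dots> = f * g - swap_vars i (f * g)"
    unfolding mult_ddiff by (simp add: swap_vars_mult algebra_simps)
  finally show "(Var i - Var (Suc i)) * (ddiff i f * g + swap_vars i f * ddiff i g) =
      f * g - swap_vars i (f * g)" .
qed

lemma ddiff_mult_sym: "swap_vars i f = f \<Longrightarrow> ddiff i (f * g) = f * ddiff i g"
  by (simp add: ddiff_mult ddiff_sym)

lemma ddiff_Var_mult: "ddiff i (Var i * g) = g + Var (Suc i) * ddiff i g"
proof -
  have "ddiff i (Var i) = 1" by (rule ddiff_eqI) (simp add: swap_vars_Var)
  then show ?thesis by (simp add: ddiff_mult swap_vars_Var)
qed

section \<open>Commutation and braid relations of divided differences\<close>

lemma swap_vars_mult_ddiff: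
  "(swap_vars k (Var i) - swap_vars k (Var (Suc i))) * swap_vars k (ddiff i f)
    = swap_vars k f - swap_vars k (swap_vars i f)"
  using arg_cong[OF mult_ddiff[of i f], of "swap_vars k"]
  by (simp add: swap_vars_mult swap_vars_diff)

text \<open>Multiplied by both denominators, either side is the signed sum of f over the group
  generated by the two commuting transpositions.\<close>

lemma ddiff_commute:
  assumes "Suc i < j"
  shows "ddiff i (ddiff j f) = ddiff j (ddiff i f)"
proof -
  let ?a = "Var i - Var (Suc i)" and ?b = "Var j - Var (Suc j)"
  have i: "?b * swap_vars i (ddiff j f) = swap_vars i f - swap_vars i (swap_vars j f)"
    using swap_vars_mult_ddiff[of i j f] assms by (simp add: swap_vars_Var)
  have j: "?a * swap_vars j (ddiff i f) = swap_vars j f - swap_vars j (swap_vars i f)"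
    using swap_vars_mult_ddiff[of j i f] assms by (simp add: swap_vars_Var)
  have "?b * (?a * ddiff i (ddiff j f)) = ?a * (?b * ddiff j (ddiff i f))"
    unfolding mult_ddiff right_diff_distrib i j mult_ddiff
    using swap_vars_commute[OF assms, of f] by (simp add: algebra_simps)
  then have "(?a * ?b) * ddiff i (ddiff j f) = (?a * ?b) * ddiff j (ddiff i f)"
    by (simp only: mult.assoc mult.left_commute)
  then show ?thesis using assms by (subst (asm) mult_left_cancel) auto
qed

lemma ddiff_braid:
  "ddiff i (ddiff (Suc i) (ddiff i f)) = ddiff (Suc i) (ddiff i (ddiff (Suc i) f))"
proof -
  let ?a = "Var i" and ?b = "Var (Suc i)" and ?c = "Var (Suc (Suc i))"
  let ?s = "swap_vars i" and ?t = "swap_vars (Suc i)"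
  let ?f = "ddiff i" and ?g = "ddiff (Suc i)"
  have Var_swap: "?s ?a = ?b" "?s ?b = ?a" "?s ?c = ?c" "?t ?a = ?a" "?t ?b = ?c" "?t ?c = ?b"
    by (simp_all add: swap_vars_Var)
  have s1: "(?a - ?b) * ?f h = h - ?s h" for h by (rule mult_ddiff)
  have s2: "(?b - ?c) * ?g h = h - ?t h" for h by (rule mult_ddiff)
  have s3: "(?a - ?c) * ?s (?g h) = ?s h - ?s (?t h)" for h
    using swap_vars_mult_ddiff[of i "Suc i" h] by (simp only: Var_swap)
  have s4: "(?a - ?c) * ?t (?f h) = ?t h - ?t (?s h)" for h
    using swap_vars_mult_ddiff[of "Suc i" i h] by (simp only: Var_swap)
  have s5: "(?b - ?c) * ?s (?t (?f h)) = ?s (?t h) - ?s (?t (?s h))" for h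
    using arg_cong[OF s4, of ?s h] by (simp add: swap_vars_mult swap_vars_diff Var_swap)
  have s6: "(?a - ?b) * ?t (?s (?g h)) = ?t (?s h) - ?t (?s (?t h))" for h
    using arg_cong[OF s3, of ?t h] by (simp add: swap_vars_mult swap_vars_diff Var_swap)
  \<comment> \<open>The signed sum of f over the six elements of the group generated by the two
    transpositions. Both sides of the braid relation, multiplied by the Vandermonde product (a -
    b)(a - c)(b - c), are shown to equal it; the product is then cancelled.\<close>
  define S where "S = f - ?s f - ?t f + ?t (?s f) + ?s (?t f) - ?s (?t (?s f))"
  have "(?b - ?c) * (?a - ?c) * ((?a - ?b) * ?f (?g (?f f)))
      = (?a - ?c) * ((?b - ?c) * ?g (?f f)) - (?b - ?c) * ((?a - ?c) * ?s (?g (?f f)))"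
    unfolding s1 by (simp add: algebra_simps)
  also have "\<dots> = (?a - ?b) * ?f f - (?a - ?c) * ?t (?f f) + (?b - ?c) * ?s (?t (?f f))"
    unfolding s2 s3 by (simp add: algebra_simps)
  also have "\<dots> = S"
    unfolding s1 s4 s5 S_def by (simp add: algebra_simps)
  finally have l: "(?b - ?c) * (?a - ?c) * ((?a - ?b) * ?f (?g (?f f))) = S" .
  have "(?a - ?b) * (?a - ?c) * ((?b - ?c) * ?g (?f (?g f)))
      = (?a - ?c) * ((?a - ?b) * ?f (?g f)) - (?a - ?b) * ((?a - ?c) * ?t (?f (?g f)))"
    unfolding s2 by (simp add: algebra_simps)
  also have "\<dots> = (?b - ?c) * ?g f - (?a - ?c) * ?s (?g f) + (?a - ?b) * ?t (?s (?g f))"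
    unfolding s1 s4 by (simp add: algebra_simps)
  also have "\<dots> = S"
    unfolding s2 s3 s6 S_def swap_vars_braid by (simp add: algebra_simps)
  finally have r: "(?a - ?b) * (?a - ?c) * ((?b - ?c) * ?g (?f (?g f))) = S" .
  have "((?a - ?b) * (?a - ?c) * (?b - ?c)) * ?f (?g (?f f)) =
      ((?a - ?b) * (?a - ?c) * (?b - ?c)) * ?g (?f (?g f))"
    using l r by (simp only: mult.assoc mult.left_commute)
  then show ?thesis by (subst (asm) mult_left_cancel) auto
qed


section \<open>Normal forms and reduced words\<close>

lemma perm_of_Nil [simp]: "perm_of [] = id"
  by (simp add: perm_of_def)

lemma perm_of_Cons [simp]: "perm_of (k # w) = transpose k (Suc k) \<circ> perm_of w"
  by (simp add: perm_of_def)

lemma perm_of_append [simp]: "perm_of (v @ w) = perm_of v \<circ> perm_of w"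
  by (induction v) (simp_all add: o_assoc)

lemma ddiff_word_Nil [simp]: "ddiff_word [] f = f"
  by (simp add: ddiff_word_def)

lemma ddiff_word_Cons [simp]: "ddiff_word (k # w) f = ddiff k (ddiff_word w f)"
  by (simp add: ddiff_word_def)

lemma ddiff_word_append [simp]: "ddiff_word (v @ w) f = ddiff_word v (ddiff_word w f)"
  by (simp add: ddiff_word_def)

lemma ddiff_word_0 [simp]: "ddiff_word w 0 = 0"
  by (induction w) simp_all

lemma ddiff_word_add: "ddiff_word w (f + g) = ddiff_word w f + ddiff_word w g"
  by (induction w) (simp_all add: ddiff_add)

lemma ddiff_word_sum: "ddiff_word w (\<Sum>x\<in>A. f x) = (\<Sum>x\<in>A. ddiff_word w (f x))"
  by (induction A rule: infinite_finite_induct) (simp_all add: ddiff_word_add)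

lemma ddiff_word_mult_sym:
  assumes "\<And>k. k \<in> set w \<Longrightarrow> swap_vars k f = f"
  shows "ddiff_word w (f * g) = f * ddiff_word w g"
  using assms by (induction w) (simp_all add: ddiff_mult_sym)

lemma perm_of_permutes:
  assumes "set w \<subseteq> {1..<n}"
  shows "perm_of w permutes {1..n}"
  using assms
proof (induction w)
  case (Cons k w)
  then have "transpose k (Suc k) permutes {1..n}"
    by (intro permutes_swap_id) auto
  with Cons show ?case
    unfolding perm_of_Cons by (intro permutes_compose) auto
qed simp

lemma set_s_word [simp]: "set (s_word i j) = {j..i}"
  by (auto simp: s_word_def)

lemma s_word_empty: "s_word i (Suc i) = []"
  by (simp add: s_word_def)

lemma s_word_snoc: "j \<le> i \<Longrightarrow> s_word i j = s_word i (Suc j) @ [j]"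
  by (simp add: s_word_def upt_conv_Cons del: upt_Suc)

text \<open>This is what makes the last index of a normal form readable from the permutation: it is
  the preimage of \<open>Suc n\<close>.\<close>

lemma perm_of_s_word:
  assumes "j \<le> Suc n"
  shows "perm_of (s_word n j) j = Suc n"
  using assms
proof (induction j rule: inc_induct)
  case base
  then show ?case by (simp add: s_word_empty)
next
  case (step j)
  then show ?case by (simp add: s_word_snoc[of j n])
qed

text \<open>Stands in for equality in the nilCoxeter monoid by recording three invariants of
  commutation and braid moves.\<close>

definition nil_eq :: "nat list \<Rightarrow> nat list \<Rightarrow> bool" where
  "nil_eq v w \<longleftrightarrow> length v = length w \<and> perm_of v = perm_of w \<and>
    (\<forall>f. ddiff_word v f = ddiff_word w f)"

lemma nil_eq_refl [simp]: "nil_eq w w"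
  by (simp add: nil_eq_def)

lemma nil_eq_trans [trans]: "nil_eq u v \<Longrightarrow> nil_eq v w \<Longrightarrow> nil_eq u w"
  by (simp add: nil_eq_def)

lemma nil_eq_append: "nil_eq v w \<Longrightarrow> nil_eq v' w' \<Longrightarrow> nil_eq (v @ v') (w @ w')"
  by (simp add: nil_eq_def)

lemma nil_eq_commute:
  assumes "Suc i < j \<or> Suc j < i"
  shows "nil_eq [i, j] [j, i]"
proof -
  have "ddiff i (ddiff j f) = ddiff j (ddiff i f)" for f
    using assms ddiff_commute[of i j f] ddiff_commute[of j i f] by auto
  with assms show ?thesis
    by (auto simp: nil_eq_def fun_eq_iff transpose_def)
qed

lemma nil_eq_braid: "nil_eq [Suc i, i, Suc i] [i, Suc i, i]"
  by (auto simp: nil_eq_def ddiff_braid fun_eq_iff transpose_def)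

lemma nil_eq_commute_word:
  assumes "\<And>j. j \<in> set w \<Longrightarrow> Suc k < j \<or> Suc j < k"
  shows "nil_eq (w @ [k]) ([k] @ w)"
  using assms
proof (induction w)
  case (Cons j w)
  then have "nil_eq (j # w @ [k]) ([j] @ [k] @ w)"
    using nil_eq_append[of "[j]" "[j]" "w @ [k]" "[k] @ w"] by simp
  also have "nil_eq \<dots> ([k, j] @ w)"
    using nil_eq_append[OF nil_eq_commute[of j k] nil_eq_refl[of w]] Cons.prems[of j] by auto
  finally show ?case by simp
qed simp

text \<open>The letter \<open>Suc k\<close> commutes with the letters below k, the braid relation at
  \<open>Suc k\<close>, k trades it for a letter k, and this commutes with all letters above
  \<open>Suc k\<close>.\<close>

lemma nil_eq_s_word_greater:
  assumes "j \<le> k" "k < n"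
  shows "nil_eq (s_word n j @ [Suc k]) ([k] @ s_word n j)"
proof -
  let ?u = "s_word n (Suc (Suc k))" and ?v = "rev [j..<k]"
  have "[j..<Suc n] = [j..<k] @ [k..<Suc n]"
    using assms upt_add_eq_append[of j k "Suc n - k"] by (simp del: upt_Suc)
  also have "[k..<Suc n] = [k, Suc k] @ [Suc (Suc k)..<Suc n]"
    using assms by (simp add: upt_conv_Cons del: upt_Suc)
  finally have split: "s_word n j = ?u @ [Suc k, k] @ ?v"
    by (simp add: s_word_def del: upt_Suc)
  have "nil_eq (?u @ [Suc k, k] @ (?v @ [Suc k])) (?u @ [Suc k, k] @ ([Suc k] @ ?v))"
    by (intro nil_eq_append nil_eq_refl nil_eq_commute_word) auto
  also have "\<dots> = ?u @ [Suc k, k, Suc k] @ ?v" by simp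
  also have "nil_eq \<dots> (?u @ [k, Suc k, k] @ ?v)"
    by (intro nil_eq_append nil_eq_refl nil_eq_braid)
  also have "\<dots> = (?u @ [k]) @ [Suc k, k] @ ?v" by simp
  also have "nil_eq \<dots> (([k] @ ?u) @ [Suc k, k] @ ?v)"
    by (intro nil_eq_append nil_eq_refl nil_eq_commute_word) auto
  finally show ?thesis by (simp add: split)
qed

section \<open>Existence and uniqueness of normal forms\<close>

definition valid :: "nat \<Rightarrow> (nat \<Rightarrow> nat) \<Rightarrow> bool" where
  "valid n i \<longleftrightarrow> (\<forall>j\<in>{1..<n}. 1 \<le> i j \<and> i j \<le> Suc j)"

lemma nf_word_Suc: "1 \<le> n \<Longrightarrow> nf_word (Suc n) i = nf_word n i @ s_word n (i n)"
  by (simp add: nf_word_def)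

lemma nf_word_trivial [simp]: "nf_word 0 i = []" "nf_word (Suc 0) i = []"
  by (simp_all add: nf_word_def)

lemma nf_word_cong: "(\<And>j. j \<in> {1..<n} \<Longrightarrow> i j = i' j) \<Longrightarrow> nf_word n i = nf_word n i'"
  by (auto simp: nf_word_def intro!: arg_cong[where f = concat])

lemma nf_word_upd [simp]: "nf_word n (i(n := a)) = nf_word n i"
  by (rule nf_word_cong) auto

lemma valid_Suc: "valid (Suc n) i \<longleftrightarrow> valid n i \<and> (1 \<le> n \<longrightarrow> 1 \<le> i n \<and> i n \<le> Suc n)"
  by (auto simp: valid_def less_Suc_eq)

lemma valid_upd [simp]: "valid n (i(n := a)) = valid n i"
  by (auto simp: valid_def)

text \<open>Adjoins a last index. A plain function update suffices because \<open>valid\<close>,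
  unlike \<open>nf_indices\<close>, leaves the values outside the range free.\<close>

lemma valid_upd_Suc: "valid n i \<Longrightarrow> 1 \<le> a \<Longrightarrow> a \<le> Suc n \<Longrightarrow> valid (Suc n) (i(n := a))"
  unfolding valid_Suc valid_upd by simp

lemma nf_word_upd_Suc: "1 \<le> n \<Longrightarrow> nf_word (Suc n) (i(n := a)) = nf_word n i @ s_word n a"
  unfolding nf_word_upd nf_word_Suc by simp

lemma set_nf_word: "valid n i \<Longrightarrow> set (nf_word n i) \<subseteq> {1..<n}"
  by (fastforce simp: valid_def nf_word_def)

lemma perm_of_nf_word_permutes: "valid n i \<Longrightarrow> perm_of (nf_word n i) permutes {1..n}"
  by (intro perm_of_permutes set_nf_word)

lemma perm_of_nf_word_Suc:
  assumes "valid (Suc n) i" "1 \<le> n"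
  shows "perm_of (nf_word (Suc n) i) (i n) = Suc n"
proof -
  have "perm_of (nf_word n i) (Suc n) = Suc n"
    using perm_of_nf_word_permutes[of n i] assms by (auto simp: valid_Suc permutes_def)
  with assms show ?thesis by (simp add: nf_word_Suc valid_Suc perm_of_s_word)
qed

lemma perm_of_bij: "bij (perm_of w)"
  by (induction w) (simp_all only: perm_of_Nil perm_of_Cons bij_id bij_comp bij_transpose)

text \<open>The last index is the preimage of the largest point. Cancelling the common last factor
  on the right leaves two normal forms on one letter fewer.\<close>

lemma nf_word_unique:
  assumes "valid n i" "valid n i'" "perm_of (nf_word n i) = perm_of (nf_word n i')"
    and "j \<in> {1..<n}"
  shows "i j = i' j"
  using assms
proof (induction n arbitrary: j)
  case (Suc n)
  then have n: "1 \<le> n" by auto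
  have "perm_of (nf_word (Suc n) i) (i n) = perm_of (nf_word (Suc n) i) (i' n)"
    using perm_of_nf_word_Suc[of n i] perm_of_nf_word_Suc[of n i'] Suc.prems n by simp
  then have eq: "i n = i' n"
    using perm_of_bij[THEN bij_is_inj] by (meson injD)
  have "perm_of (nf_word n i) \<circ> perm_of (s_word n (i n)) =
      perm_of (nf_word n i') \<circ> perm_of (s_word n (i n))"
    using Suc.prems(3) n eq by (simp only: nf_word_Suc perm_of_append)
  then have "perm_of (nf_word n i) = perm_of (nf_word n i')"
    using bij_is_surj[OF perm_of_bij[of "s_word n (i n)"]]
    by (metis surj_fun_eq comp_apply)
  then show ?case
    using Suc eq by (cases "j = n") (auto simp: valid_Suc)
qed simp

lemma nf_word_exists:
  assumes "p permutes {1..n}"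
  shows "\<exists>i. valid n i \<and> perm_of (nf_word n i) = p"
  using assms
proof (induction n arbitrary: p)
  case 0
  then show ?case by (auto simp: valid_def)
next
  case (Suc n)
  show ?case
  proof (cases "n = 0")
    case True
    with Suc.prems show ?thesis by (auto simp: valid_def)
  next
    case False
    \<comment> \<open>By \<open>perm_of_nf_word_Suc\<close> the last index has to be the preimage of
      \<open>Suc n\<close>; dividing by its factor leaves a permutation that fixes
      \<open>Suc n\<close>.\<close>
    obtain a where a: "a \<in> {1..Suc n}" "p a = Suc n"
      using permutes_image[OF Suc.prems] by (metis atLeastAtMost_iff imageE le_refl le_add1 plus_1_eq_Suc)
    let ?s = "perm_of (s_word n a)"
    have s: "?s permutes {1..Suc n}" using a by (intro perm_of_permutes) auto
    have "(p \<circ> inv ?s) permutes {1..Suc n}"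
      by (rule permutes_compose[OF permutes_inv[OF s] Suc.prems])
    moreover have "(p \<circ> inv ?s) (Suc n) = Suc n"
      using a perm_of_s_word[of a n] perm_of_bij
      by (metis atLeastAtMost_iff bij_inv_eq_iff comp_apply)
    ultimately have "(p \<circ> inv ?s) permutes {1..n}"
      by (rule_tac permutes_superset) (auto simp: le_Suc_eq)
    then obtain i where i: "valid n i" "perm_of (nf_word n i) = p \<circ> inv ?s"
      using Suc.IH by blast
    have "valid (Suc n) (i(n := a))"
      using i a by (auto simp: valid_Suc)
    moreover have "perm_of (nf_word (Suc n) (i(n := a))) = p"
      using i False permutes_inv_o(2)[OF s] by (simp add: nf_word_Suc o_assoc[symmetric])
    ultimately show ?thesis by blast
  qed
qed

lemma nf_correct:
  assumes "p permutes {1..n}"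
  shows "valid n (nf n p)" "perm_of (nf_word n (nf n p)) = p"
proof -
  obtain i where i: "valid n i" "perm_of (nf_word n i) = p"
    using nf_word_exists[OF assms] by blast
  have "\<exists>!i. i \<in> nf_indices n \<and> perm_of (nf_word n i) = p"
  \<comment> \<open>\<open>nf_indices\<close> consists of extensional functions, hence the
    restriction of the witness.\<close>
  proof (intro ex1I[of _ "restrict i {1..n - 1}"] conjI)
    show "restrict i {1..n - 1} \<in> nf_indices n"
      using i(1) by (auto simp: nf_indices_def valid_def PiE_def Pi_def)
    show "perm_of (nf_word n (restrict i {1..n - 1})) = p"
      by (subst nf_word_cong[of n _ i]) (auto simp: i(2))
    fix i' assume i': "i' \<in> nf_indices n \<and> perm_of (nf_word n i') = p"
    then have "valid n i'" by (auto simp: nf_indices_def valid_def PiE_def Pi_def)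
    then have "\<And>j. j \<in> {1..<n} \<Longrightarrow> i' j = i j"
      using nf_word_unique i i' by metis
    then show "i' = restrict i {1..n - 1}"
      using i' by (auto simp: nf_indices_def PiE_def extensional_def fun_eq_iff)
  qed
  from theI'[OF this] have *: "nf n p \<in> nf_indices n \<and> perm_of (nf_word n (nf n p)) = p"
    by (simp add: nf_def)
  then show "valid n (nf n p)" by (auto simp: nf_indices_def valid_def PiE_def Pi_def)
  from * show "perm_of (nf_word n (nf n p)) = p" by blast
qed

text \<open>Rewriting of words in the nilCoxeter monoid: a cancellation \<open>s\<^sub>k s\<^sub>k = 1\<close> of permutations kills
  the divided difference.\<close>

definition nil_step :: "nat list \<Rightarrow> nat list \<Rightarrow> bool" where
  "nil_step w w' \<longleftrightarrow> perm_of w' = perm_of w \<and>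
    (length w' = length w \<and> (\<forall>f. ddiff_word w f = ddiff_word w' f) \<or>
     length w' < length w \<and> (\<forall>f. ddiff_word w f = 0))"

lemma nil_step_append: "nil_step v v' \<Longrightarrow> nil_step (v @ w) (v' @ w)"
  by (auto simp: nil_step_def)

lemma nil_eq_nil_step: "nil_eq v w \<Longrightarrow> nil_step v w"
  by (auto simp: nil_step_def nil_eq_def)

lemma nil_step_trans [trans]: "nil_step u v \<Longrightarrow> nil_step v w \<Longrightarrow> nil_step u w"
  by (auto simp: nil_step_def)

text \<open>With a the last index, the letter a - 1 lengthens the last factor and the letter a
  cancels against its end. A smaller letter passes through unchanged, a larger one k comes out as k
  - 1; in these two cases the letter is absorbed by the earlier factors by induction.\<close>

lemma nf_word_snoc:
  assumes "valid n i" "1 \<le> k" "k < n"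
  shows "\<exists>i'. valid n i' \<and> nil_step (nf_word n i @ [k]) (nf_word n i')"
  using assms
proof (induction n arbitrary: i k)
  case (Suc n)
  then have n: "1 \<le> n" and a: "1 \<le> i n" "i n \<le> Suc n" and v: "valid n i"
    by (auto simp: valid_Suc)
  have move: ?case if l: "nil_eq (s_word n (i n) @ [k]) ([l] @ s_word n (i n))" "1 \<le> l" "l < n" for l
  proof -
    obtain i' where i': "valid n i'" "nil_step (nf_word n i @ [l]) (nf_word n i')"
      using Suc.IH[OF v l(2,3)] by blast
    have "nil_step (nf_word n i @ (s_word n (i n) @ [k])) (nf_word n i @ ([l] @ s_word n (i n)))"
      by (intro nil_eq_nil_step nil_eq_append nil_eq_refl l)
    also have "\<dots> = (nf_word n i @ [l]) @ s_word n (i n)" by simp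
    also have "nil_step \<dots> (nf_word n i' @ s_word n (i n))"
      by (rule nil_step_append[OF i'(2)])
    finally have "nil_step (nf_word (Suc n) i @ [k]) (nf_word (Suc n) (i'(n := i n)))"
      unfolding nf_word_Suc[OF n, of i] nf_word_upd_Suc[OF n] by simp
    with valid_upd_Suc[OF i'(1) a] show ?thesis by blast
  qed
  consider "Suc k = i n" | "k = i n" | "Suc k < i n" | "i n < k" by linarith
  then show ?case
  proof cases
    case 1
    then have "s_word n k = s_word n (i n) @ [k]"
      using s_word_snoc[of k n] Suc.prems by simp
    then have "nil_step (nf_word (Suc n) i @ [k]) (nf_word (Suc n) (i(n := k)))"
      unfolding nf_word_Suc[OF n, of i] nf_word_upd_Suc[OF n] by (simp add: nil_step_def)
    with valid_upd_Suc[OF v, of k] Suc.prems show ?thesis by auto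
  next
    case 2
    then have "s_word n (i n) = s_word n (Suc k) @ [k]"
      using s_word_snoc[of k n] Suc.prems by simp
    then have "nil_step (nf_word (Suc n) i @ [k]) (nf_word (Suc n) (i(n := Suc k)))"
      unfolding nf_word_Suc[OF n, of i] nf_word_upd_Suc[OF n]
      by (simp add: nil_step_def ddiff_ddiff fun_eq_iff)
    with valid_upd_Suc[OF v, of "Suc k"] Suc.prems show ?thesis by auto
  next
    case 3
    then show ?thesis
      using Suc.prems a by (intro move[of k] nil_eq_commute_word) auto
  next
    case 4
    then show ?thesis
      using Suc.prems a nil_eq_s_word_greater[of "i n" "k - 1" n] by (intro move[of "k - 1"]) auto
  qed
qed simp

lemma nf_word_nil_step:
  assumes "set w \<subseteq> {1..<n}"
  shows "\<exists>i. valid n i \<and> nil_step w (nf_word n i)"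
  using assms
proof (induction w rule: rev_induct)
  case Nil
  have "nf_word n Suc = []" by (simp add: nf_word_def s_word_empty)
  then show ?case by (intro exI[of _ Suc]) (simp add: valid_def nil_step_def)
next
  case (snoc k w)
  then obtain i where i: "valid n i" "nil_step w (nf_word n i)" by auto
  then obtain i' where "valid n i'" "nil_step (nf_word n i @ [k]) (nf_word n i')"
    using nf_word_snoc snoc.prems by (metis atLeastLessThan_iff insert_subset list.simps(15) set_append
        le_sup_iff)
  then show ?case
    using nil_step_trans[OF nil_step_append[OF i(2)]] by blast
qed

lemma nil_step_nf:
  assumes "set w \<subseteq> {1..<n}"
  shows "nil_step w (nf_word n (nf n (perm_of w)))"
proof -
  obtain i where i: "valid n i" "nil_step w (nf_word n i)"
    using nf_word_nil_step[OF assms] by blast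
  note nf = nf_correct[OF perm_of_permutes[OF assms]]
  have "nf_word n i = nf_word n (nf n (perm_of w))"
    using nf_word_unique[OF i(1) nf(1)] i(2) nf(2) by (intro nf_word_cong) (simp add: nil_step_def)
  with i(2) show ?thesis by simp
qed

text \<open>Every word rewrites to the normal form of its permutation without growing, so the normal
  form has the least possible length.\<close>

lemma reduced_iff_length_nf:
  assumes "set w \<subseteq> {1..<n}"
  shows "reduced n w \<longleftrightarrow> length (nf_word n (nf n (perm_of w))) = length w"
proof
  note nf = nf_correct[OF perm_of_permutes[OF assms]]
  have "length (nf_word n (nf n (perm_of w))) \<le> length w"
    using nil_step_nf[OF assms] by (auto simp: nil_step_def)
  moreover assume "reduced n w"
  then have "length w \<le> length (nf_word n (nf n (perm_of w)))"
    using nf set_nf_word by (auto simp: reduced_def)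
  ultimately show "length (nf_word n (nf n (perm_of w))) = length w" by simp
next
  assume "length (nf_word n (nf n (perm_of w))) = length w"
  then show "reduced n w"
    unfolding reduced_def using nil_step_nf[of _ n] by (metis nil_step_def less_or_eq_imp_le)
qed

text \<open>Equality of the lengths excludes the shortening alternative of \<open>nil_step\<close>,
  and the other one preserves the divided difference.\<close>

lemma ddiff_word_nf:
  assumes "set w \<subseteq> {1..<n}" "reduced n w"
  shows "ddiff_word w f = ddiff_word (nf_word n (nf n (perm_of w))) f"
  using nil_step_nf[OF assms(1)] reduced_iff_length_nf[OF assms(1)] assms(2)
  by (auto simp: nil_step_def)

text \<open>Here the rewriting to normal form must shorten the word, so a cancellation has
  occurred.\<close>

lemma ddiff_word_not_reduced:
  assumes "set w \<subseteq> {1..<n}" "\<not> reduced n w"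
  shows "ddiff_word w f = 0"
  using nil_step_nf[OF assms(1)] reduced_iff_length_nf[OF assms(1)] assms(2)
  by (auto simp: nil_step_def)


section \<open>One step of the expansion\<close>

lemma ddiff_prod_Var_powers:
  assumes "k \<in> {1..<n}" "e k = Suc (e (Suc k))"
  shows "ddiff k (\<Prod>j = 1..n. Var j ^ e j) = (\<Prod>j = 1..n. Var j ^ (e(k := e (Suc k))) j)"
proof -
  let ?e = "e(k := e (Suc k))" and ?\<tau> = "transpose k (Suc k)"
  let ?P = "\<Prod>j = 1..n. Var j ^ ?e j"
  have \<tau>: "?\<tau> permutes {1..n}" using assms by (intro permutes_swap_id) auto
  have "swap_vars k ?P = (\<Prod>j = 1..n. Var (?\<tau> j) ^ ?e (?\<tau> j))"
    unfolding swap_vars_prod swap_vars_power swap_vars_Var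
    by (rule prod.cong) (auto simp: transpose_def)
  also have "\<dots> = ?P"
    using prod.permute[OF \<tau>, of "\<lambda>j. Var j ^ ?e j"] by (simp add: o_def)
  finally have sym: "swap_vars k ?P = ?P" .
  \<comment> \<open>Isolating the factor at k exposes one surplus \<open>Var k\<close>; the rest is
    symmetric in the two variables, and the divided difference of \<open>Var k\<close> is 1.\<close>
  have k: "{1..n} = insert k ({1..n} - {k})" using assms by auto
  have "(\<Prod>j = 1..n. Var j ^ e j) = Var k * ?P"
    by (subst (1 2) k, subst (1 2) prod.insert) (auto simp: assms(2) mult.assoc)
  also have "\<dots> = ?P * (Var k * 1)" by (simp add: mult.commute)
  finally show ?thesis
    by (simp only: ddiff_mult_sym[OF sym] ddiff_Var_mult) (simp add: ddiff_sym)
qed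

lemma schubert_w0_alt: "schubert_w0 n = (\<Prod>j = 1..n. Var j ^ (n - j))"
  unfolding schubert_w0_def by (cases n) simp_all

definition var_prod :: "nat \<Rightarrow> poly" where
  "var_prod a = (\<Prod>k = 1..a. Var k)"

lemma var_prod_Suc: "var_prod (Suc a) = var_prod a * Var (Suc a)"
  by (simp add: var_prod_def)

lemma s_word_Cons: "j \<le> Suc i \<Longrightarrow> s_word (Suc i) j = Suc i # s_word i j"
  by (simp add: s_word_def)

lemma ddiff_s_word_schubert_w0:
  assumes "i \<le> n"
  shows "ddiff_word (s_word n (Suc i)) (schubert_w0 (Suc n)) = var_prod i * schubert_w0 n"
proof -
  \<comment> \<open>Generalised to partial factors: the letters \<open>Suc i\<close>, ..., k, acting
    in this order, have each lowered the exponent of their own variable by one, to that of the next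
    variable.\<close>
  have "k \<le> n \<Longrightarrow> ddiff_word (s_word k (Suc i)) (schubert_w0 (Suc n)) =
      (\<Prod>j = 1..Suc n. Var j ^ (if i < j \<and> j \<le> k then n - j else Suc n - j))" if "i \<le> k" for k
    using that
  proof (induction k rule: dec_induct)
    case base
    show ?case
      unfolding s_word_empty schubert_w0_alt ddiff_word_Nil by (rule prod.cong) auto
  next
    case (step k)
    let ?e = "\<lambda>j. if i < j \<and> j \<le> k then n - j else Suc n - j"
    have "ddiff_word (s_word (Suc k) (Suc i)) (schubert_w0 (Suc n)) =
        ddiff (Suc k) (\<Prod>j = 1..Suc n. Var j ^ ?e j)"
      using step by (simp add: s_word_Cons del: prod.cl_ivl_Suc)
    also have "\<dots> = (\<Prod>j = 1..Suc n. Var j ^ (?e(Suc k := ?e (Suc (Suc k)))) j)"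
      by (rule ddiff_prod_Var_powers) (use step in \<open>auto simp: Suc_diff_le\<close>)
    also have "\<dots> =
        (\<Prod>j = 1..Suc n. Var j ^ (if i < j \<and> j \<le> Suc k then n - j else Suc n - j))"
      using step by (intro prod.cong) auto
    finally show ?case .
  qed
  from this[OF assms] have "ddiff_word (s_word n (Suc i)) (schubert_w0 (Suc n)) =
      (\<Prod>j = 1..n. Var j ^ (if i < j then n - j else Suc n - j))"
    unfolding prod.cl_ivl_Suc by (simp del: prod.cl_ivl_Suc)
  also have "\<dots> = (\<Prod>j = 1..n. (if j \<in> {1..i} then Var j else 1) * Var j ^ (n - j))"
    by (intro prod.cong) (auto simp: Suc_diff_le)
  also have "\<dots> = (\<Prod>j = 1..n. if j \<in> {1..i} then Var j else 1) * schubert_w0 n"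
    by (simp only: prod.distrib schubert_w0_alt)
  also have "(\<Prod>j = 1..n. if j \<in> {1..i} then Var j else 1) = var_prod i"
    using assms by (simp only: var_prod_def prod.inter_restrict[symmetric] finite_atLeastAtMost)
      (simp add: Int_absorb1)
  finally show ?thesis .
qed

section \<open>One factor acting on a product of initial variables\<close>

lemma swap_vars_var_prod:
  assumes "k \<noteq> a" "1 \<le> k"
  shows "swap_vars k (var_prod a) = var_prod a"
proof (cases "k < a")
  case True
  then have "transpose k (Suc k) permutes {1..a}"
    using assms by (intro permutes_swap_id) auto
  from prod.permute[OF this, of Var] show ?thesis
    by (simp add: var_prod_def swap_vars_prod swap_vars_Var o_def)
next
  case False
  then show ?thesis
    using assms unfolding var_prod_def swap_vars_prod
    by (intro prod.cong) (auto simp: swap_vars_Var_other)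
qed

lemma ddiff_var_prod_mult:
  "ddiff (Suc a) (var_prod (Suc a) * g)
    = var_prod a * (g + Var (Suc (Suc a)) * ddiff (Suc a) g)"
  by (simp add: var_prod_Suc mult.assoc ddiff_mult_sym swap_vars_var_prod ddiff_Var_mult)

lemma ddiff_sum: "ddiff k (\<Sum>x\<in>A. f x) = (\<Sum>x\<in>A. ddiff k (f x))"
  using ddiff_word_sum[of "[k]"] by simp

text \<open>The letters below \<open>Suc a\<close> pass through the product. From
  \<open>Suc a\<close> on, each letter either is deleted and consumes the travelling variable, or
  stays and pushes it one index up. The sum over t collects the deletions so far; the last summand
  is the case where the variable has survived every letter.\<close>

lemma ddiff_s_word_var_prod_aux:
  assumes "1 \<le> b" "b \<le> Suc a" "Suc a \<le> j"
  shows "ddiff_word (s_word j b) (var_prod (Suc a) * f) =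
    var_prod a * ((\<Sum>t = Suc a..j. ddiff_word (s_word_del j b t) f) +
      Var (Suc j) * ddiff_word (s_word j b) f)"
  using assms(3)
proof (induction j rule: dec_induct)
  case base
  have "ddiff_word (s_word a b) (var_prod (Suc a) * f) = var_prod (Suc a) * ddiff_word (s_word a b) f"
    using assms by (intro ddiff_word_mult_sym swap_vars_var_prod) auto
  then show ?case
    using assms by (simp add: s_word_Cons ddiff_var_prod_mult s_word_del_def)
next
  case (step j)
  have "ddiff_word (s_word (Suc j) b) (var_prod (Suc a) * f) =
      var_prod a * ddiff (Suc j) ((\<Sum>t = Suc a..j. ddiff_word (s_word_del j b t) f) +
      Var (Suc j) * ddiff_word (s_word j b) f)"
    using assms step by (simp add: s_word_Cons ddiff_mult_sym swap_vars_var_prod)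
  also have "ddiff (Suc j) ((\<Sum>t = Suc a..j. ddiff_word (s_word_del j b t) f) +
      Var (Suc j) * ddiff_word (s_word j b) f) =
      (\<Sum>t = Suc a..j. ddiff_word (s_word_del (Suc j) b t) f) + ddiff_word (s_word j b) f +
      Var (Suc (Suc j)) * ddiff_word (s_word (Suc j) b) f"
    using assms step
    by (auto simp: s_word_Cons ddiff_add ddiff_sum ddiff_Var_mult s_word_del_def intro!: sum.cong)
  also have "ddiff_word (s_word j b) f = ddiff_word (s_word_del (Suc j) b (Suc j)) f"
    using assms step by (simp add: s_word_Cons s_word_del_def)
  finally show ?case using step by simp
qed

text \<open>Brings the previous formula into the shape of \<open>T_vectors\<close> and
  \<open>X_mon\<close>: the summand without deletion becomes t = \<open>Suc j\<close>, for which
  \<open>s_word_del\<close> removes nothing.\<close>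

lemma ddiff_s_word_var_prod:
  assumes "1 \<le> b" "b \<le> a" "a \<le> j"
  shows "ddiff_word (s_word j b) (var_prod a * f) =
    (\<Sum>t = a..Suc j. var_prod (a - 1) *
      (Var (Suc j) ^ of_bool (t > j) * ddiff_word (s_word_del j b t) f))"
proof -
  obtain a' where a: "a = Suc a'" using assms by (cases a) auto
  have "s_word_del j b (Suc j) = s_word j b"
    by (simp add: s_word_del_def remove1_idem)
  moreover have "(\<Sum>t = a..j. Var (Suc j) ^ of_bool (t > j) * ddiff_word (s_word_del j b t) f) =
      (\<Sum>t = a..j. ddiff_word (s_word_del j b t) f)"
    by (intro sum.cong) auto
  ultimately show ?thesis
    using assms ddiff_s_word_var_prod_aux[of b a' j f] a
    by (simp add: sum_distrib_left[symmetric])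
qed

section \<open>Expansion over the vectors of deletions\<close>

lemma sum_PiE_insert:
  assumes "x \<notin> S"
  shows "(\<Sum>t\<in>Pi\<^sub>E (insert x S) B. g t) = (\<Sum>t\<in>Pi\<^sub>E S B. \<Sum>s\<in>B x. g (t(x := s)))"
proof -
  have "(\<Sum>t\<in>Pi\<^sub>E (insert x S) B. g t) = (\<Sum>(s, t)\<in>B x \<times> Pi\<^sub>E S B. g (t(x := s)))"
    unfolding PiE_insert_eq
    by (subst sum.reindex[OF inj_combinator[OF assms]]) (simp add: case_prod_unfold o_def)
  also have "\<dots> = (\<Sum>s\<in>B x. \<Sum>t\<in>Pi\<^sub>E S B. g (t(x := s)))"
    by (simp add: sum.cartesian_product)
  finally show ?thesis by (subst sum.swap)
qed

text \<open>Positivity of the indices keeps the letter 0 out of all factors, so that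
  \<open>swap_vars_var_prod\<close> applies and a difference truncated to 0 meets no letter.\<close>

locale expansion =
  fixes i :: "nat \<Rightarrow> nat" and r :: nat
  assumes i_pos: "\<And>j. 1 \<le> j \<Longrightarrow> j < r \<Longrightarrow> 1 \<le> i j"
begin

abbreviation "q \<equiv> q_num i r"
abbreviation "m \<equiv> m_num i r"

lemma finite_M_set [simp]: "finite (M_set i r l k)"
  by (rule finite_subset[of _ "{..<k}"]) (auto simp: M_set_def)

text \<open>The least number in \<open>m_num\<close> exists: otherwise q would be an infinite
  strictly decreasing sequence of naturals.\<close>

lemma M_set_m: "M_set i r (Suc m) (q m) = {}"
proof -
  have "\<exists>l. M_set i r (Suc l) (q l) = {}"
  proof (rule ccontr)
    assume "\<not> ?thesis"
    then have "q (Suc l) \<in> M_set i r (Suc l) (q l)" for l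
      using Max_in[of "M_set i r (Suc l) (q l)"] by simp
    then have "q (Suc l) < q l" for l by (simp add: M_set_def)
    then have "q l + l \<le> r" for l
    proof (induction l)
      case (Suc l)
      then show ?case by (metis add_Suc_right Suc_leI add_less_mono1 order_less_le_trans)
    qed simp
    from this[of "Suc r"] show False by simp
  qed
  then show ?thesis unfolding m_num_def by (rule LeastI_ex)
qed

lemma M_set_nonempty: "l < m \<Longrightarrow> M_set i r (Suc l) (q l) \<noteq> {}"
  unfolding m_num_def by (rule not_less_Least)

lemma q_Suc_in: "l < m \<Longrightarrow> q (Suc l) \<in> M_set i r (Suc l) (q l)"
  using Max_in[of "M_set i r (Suc l) (q l)"] M_set_nonempty by simp

lemma q_Suc:
  assumes "l < m"
  shows "1 \<le> q (Suc l)" "q (Suc l) < q l" "i (q (Suc l)) \<le> i r - Suc l" "i r - Suc l \<le> q (Suc l)"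
  using q_Suc_in[OF assms] by (auto simp: M_set_def)

lemma q_Suc_max:
  assumes "l < m" "q (Suc l) < j" "j < q l"
  shows "i r - Suc l \<notin> {i j..j}"
proof
  assume "i r - Suc l \<in> {i j..j}"
  then have "j \<in> M_set i r (Suc l) (q l)" using assms by (simp add: M_set_def)
  then have "j \<le> q (Suc l)" by simp
  with assms(2) show False by simp
qed

lemma q_mono: "l \<le> l' \<Longrightarrow> l' \<le> m \<Longrightarrow> q l' \<le> q l"
proof (induction l' rule: dec_induct)
  case (step l')
  then show ?case using q_Suc(2)[of l'] by simp
qed simp

lemma q_strict: "l < l' \<Longrightarrow> l' \<le> m \<Longrightarrow> q l' < q l"
  using q_mono[of "Suc l" l'] q_Suc(2)[of l] by simp

lemma q_le: "l \<le> m \<Longrightarrow> q l \<le> r"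
  using q_mono[of 0 l] by simp

lemma inj_on_q: "inj_on q {1..m}"
  by (rule inj_onI) (metis atLeastAtMost_iff linorder_neqE_nat q_strict less_irrefl)

text \<open>The coordinate 0 gets a singleton range, so that the allowed vectors form a dependent
  product and can be summed one coordinate at a time.\<close>

definition T_range :: "nat \<Rightarrow> nat set" where
  "T_range j = (if j = 0 then {0} else {i r - j..Suc (q j)})"

text \<open>\<open>Y l t\<close> collects the variables that left the first \<open>l\<close> factors, \<open>W a b\<close> is the part of the normal
  form between the factors \<open>a\<close> and \<open>b\<close>, and \<open>W' t a b\<close> is the same part after the deletions
  prescribed by \<open>t\<close>.\<close>

definition Y :: "nat \<Rightarrow> (nat \<Rightarrow> nat) \<Rightarrow> poly" where
  "Y l t = (\<Prod>j = 1..l. Var (Suc (q j)) ^ of_bool (t j > q j))"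

definition blk :: "(nat \<Rightarrow> nat) \<Rightarrow> nat \<Rightarrow> nat list" where
  "blk t k = (if k \<in> q ` {1..m} then s_word_del k (i k) (t (inv_into {1..m} q k)) else s_word k (i k))"

definition W :: "nat \<Rightarrow> nat \<Rightarrow> nat list" where
  "W a b = concat (map (\<lambda>k. s_word k (i k)) [a..<b])"

definition W' :: "(nat \<Rightarrow> nat) \<Rightarrow> nat \<Rightarrow> nat \<Rightarrow> nat list" where
  "W' t a b = concat (map (blk t) [a..<b])"

lemma W_append: "a \<le> b \<Longrightarrow> b \<le> c \<Longrightarrow> W a c = W a b @ W b c"
  using upt_add_eq_append[of a b "c - b"] by (simp add: W_def)

lemma W'_append: "a \<le> b \<Longrightarrow> b \<le> c \<Longrightarrow> W' t a c = W' t a b @ W' t b c"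
  using upt_add_eq_append[of a b "c - b"] by (simp add: W'_def)

lemma W_single: "W a (Suc a) = s_word a (i a)"
  by (simp add: W_def)

lemma W'_single: "W' t a (Suc a) = blk t a"
  by (simp add: W'_def)

lemma set_W: "k \<in> set (W a b) \<Longrightarrow> \<exists>j. a \<le> j \<and> j < b \<and> k \<in> {i j..j}"
  by (auto simp: W_def)

lemma set_W':
  assumes "k \<in> set (W' t a b)"
  shows "\<exists>j. a \<le> j \<and> j < b \<and> k \<in> {i j..j}"
proof -
  have "set (s_word_del j b s) \<subseteq> {b..j}" for j b s
    unfolding s_word_del_def using set_remove1_subset[of s "s_word j b"] by simp
  with assms show ?thesis
    by (fastforce simp: W'_def blk_def split: if_splits)
qed

lemma W'_eq_W:
  assumes "\<And>l. l \<in> {1..m} \<Longrightarrow> \<not> (a \<le> q l \<and> q l < b)"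
  shows "W' t a b = W a b"
  unfolding W'_def W_def
  using assms by (intro arg_cong[where f = concat] map_cong) (auto simp: blk_def)

lemma blk_q: "l \<in> {1..m} \<Longrightarrow> blk t (q l) = s_word_del (q l) (i (q l)) (t l)"
  using inv_into_f_f[OF inj_on_q, of l] by (simp add: blk_def)

text \<open>Since q decreases, the factors from \<open>q l\<close> on involve only the coordinates
  up to l. Later choices therefore leave the processed part of the word alone.\<close>

lemma W'_upd:
  assumes "l \<le> m" "l < l'"
  shows "W' (t(l' := s)) (q l) b = W' t (q l) b"
  unfolding W'_def
proof (intro arg_cong[where f = concat] map_cong refl)
  fix k assume "k \<in> set [q l..<b]"
  then have k: "q l \<le> k" by simp
  show "blk (t(l' := s)) k = blk t k"
  proof (cases "k \<in> q ` {1..m}")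
    case True
    then obtain j where j: "j \<in> {1..m}" "k = q j" by blast
    with k have "j \<le> l" using q_strict[of l j] by (meson atLeastAtMost_iff leD not_le_imp_less)
    with assms j show ?thesis by (simp only: blk_q) simp
  qed (simp add: blk_def)
qed

text \<open>The variables in \<open>Y l t\<close> have indices above \<open>q l\<close>, hence above
  both k and \<open>Suc k\<close>.\<close>

lemma swap_vars_Y:
  assumes "l \<le> m" "k < q l"
  shows "swap_vars k (Y l t) = Y l t"
  unfolding Y_def swap_vars_prod swap_vars_power
proof (intro prod.cong refl)
  fix j assume "j \<in> {1..l}"
  then have "k < q j" using q_mono[of j l] assms by simp
  then show "swap_vars k (Var (Suc (q j))) ^ of_bool (q j < t j) =
      Var (Suc (q j)) ^ of_bool (q j < t j)"
    by (simp add: swap_vars_Var_other)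
qed

lemma Y_Suc_upd:
  "Y (Suc l) (t(Suc l := s)) = Var (Suc (q (Suc l))) ^ of_bool (s > q (Suc l)) * Y l t"
  by (simp add: Y_def mult.commute)

text \<open>The factors are scanned from right to left; \<open>W 1 (q l)\<close> is still to act,
  \<open>W' t (q l) r\<close> is processed. The factors strictly between \<open>q (Suc l)\<close>
  and \<open>q l\<close> commute with the product of variables, and the factor
  \<open>q (Suc l)\<close> is expanded, its surviving variable joining Y.\<close>

lemma expansion_step:
  assumes "l < m"
  shows "ddiff_word (W 1 (q l)) (var_prod (i r - 1 - l) * (Y l t * ddiff_word (W' t (q l) r) f)) =
    (\<Sum>s\<in>T_range (Suc l). ddiff_word (W 1 (q (Suc l)))
      (var_prod (i r - 1 - Suc l) * (Y (Suc l) (t(Suc l := s)) *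
        ddiff_word (W' (t(Suc l := s)) (q (Suc l)) r) f)))"
proof -
  let ?p = "q (Suc l)" and ?a = "i r - Suc l" and ?h = "ddiff_word (W' t (q l) r) f"
  note q = q_Suc[OF assms]
  have q_r: "q l \<le> r" using q_le assms by simp
  have i_p: "1 \<le> i ?p" using i_pos[of ?p] q q_r by simp
  let ?h' = "ddiff_word (W (Suc ?p) (q l)) ?h"
  have W: "W 1 (q l) = W 1 ?p @ s_word ?p (i ?p) @ W (Suc ?p) (q l)"
    using q W_append[of 1 ?p "q l"] W_append[of ?p "Suc ?p" "q l"] by (simp add: W_single del: q_num.simps)
  \<comment> \<open>By maximality of \<open>q (Suc l)\<close>, no letter in between has the index of
    the last variable of the product.\<close>
  have letters: "1 \<le> k \<and> k \<noteq> ?a \<and> k < q l" if k: "k \<in> set (W (Suc ?p) (q l))" for k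
  proof -
    obtain j where j: "Suc ?p \<le> j" "j < q l" "k \<in> {i j..j}" using set_W[OF k] by blast
    moreover have "?a \<notin> {i j..j}" using q_Suc_max[OF assms] j by simp
    moreover have "1 \<le> i j" using i_pos[of j] j q_r by simp
    ultimately show ?thesis by auto
  qed
  have 1: "ddiff_word (W (Suc ?p) (q l)) (var_prod ?a * (Y l t * ?h)) = var_prod ?a * (Y l t * ?h')"
    using letters assms
    by (subst ddiff_word_mult_sym[OF swap_vars_var_prod], simp, simp)
      (subst ddiff_word_mult_sym[OF swap_vars_Y], auto)
  have W': "W' (t(Suc l := s)) ?p r =
      s_word_del ?p (i ?p) s @ W (Suc ?p) (q l) @ W' t (q l) r" for s
  proof -
    have "W' (t(Suc l := s)) ?p r = W' (t(Suc l := s)) ?p (Suc ?p) @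
        W' (t(Suc l := s)) (Suc ?p) (q l) @ W' (t(Suc l := s)) (q l) r"
      using q q_r W'_append[of ?p "Suc ?p" r] W'_append[of "Suc ?p" "q l" r] by (simp del: q_num.simps)
    moreover have "W' (t(Suc l := s)) (Suc ?p) (q l) = W (Suc ?p) (q l)"
    proof (rule W'_eq_W)
      fix j assume j: "j \<in> {1..m}"
      show "\<not> (Suc ?p \<le> q j \<and> q j < q l)"
        using q_mono[of "Suc l" j] q_mono[of j l] j assms by (cases "j \<le> l") (auto simp del: q_num.simps)
    qed
    moreover have "W' (t(Suc l := s)) ?p (Suc ?p) = s_word_del ?p (i ?p) s"
      using assms by (simp only: W'_single, subst blk_q) auto
    ultimately show ?thesis
      using W'_upd[of l "Suc l" t s r] assms by (simp del: q_num.simps)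
  qed
  have "ddiff_word (W 1 (q l)) (var_prod (i r - 1 - l) * (Y l t * ?h)) =
      ddiff_word (W 1 ?p) (ddiff_word (s_word ?p (i ?p)) (var_prod ?a * (Y l t * ?h')))"
    unfolding W ddiff_word_append by (simp only: 1 diff_diff_left plus_1_eq_Suc)
  also have "ddiff_word (s_word ?p (i ?p)) (var_prod ?a * (Y l t * ?h')) =
      (\<Sum>s = ?a..Suc ?p. var_prod (?a - 1) * (Var (Suc ?p) ^ of_bool (s > ?p) *
        ddiff_word (s_word_del ?p (i ?p) s) (Y l t * ?h')))"
    by (rule ddiff_s_word_var_prod) (use q i_p in auto)
  also have "\<dots> = (\<Sum>s = ?a..Suc ?p. var_prod (?a - 1) * (Y (Suc l) (t(Suc l := s)) *
        ddiff_word (W' (t(Suc l := s)) ?p r) f))"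
  proof (intro sum.cong refl)
    fix s
    have "k < q l" if "k \<in> set (s_word_del ?p (i ?p) s)" for k
      using that q set_remove1_subset[of s "s_word ?p (i ?p)"] by (auto simp: s_word_del_def simp del: q_num.simps)
    then have "ddiff_word (s_word_del ?p (i ?p) s) (Y l t * ?h') =
        Y l t * ddiff_word (s_word_del ?p (i ?p) s) ?h'"
      using assms by (intro ddiff_word_mult_sym swap_vars_Y) auto
    then show "var_prod (?a - 1) * (Var (Suc ?p) ^ of_bool (s > ?p) *
        ddiff_word (s_word_del ?p (i ?p) s) (Y l t * ?h')) =
        var_prod (?a - 1) * (Y (Suc l) (t(Suc l := s)) * ddiff_word (W' (t(Suc l := s)) ?p r) f)"
      by (simp add: W' Y_Suc_upd mult.assoc del: q_num.simps)
  qed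
  finally show ?thesis
    by (simp add: ddiff_word_sum T_range_def del: q_num.simps sum.cl_ivl_Suc)
qed

lemma expansion_upto:
  assumes "l \<le> m"
  shows "ddiff_word (W 1 r) (var_prod (i r - 1) * f) =
    (\<Sum>t\<in>Pi\<^sub>E {0..l} T_range. ddiff_word (W 1 (q l))
      (var_prod (i r - 1 - l) * (Y l t * ddiff_word (W' t (q l) r) f)))"
  using assms
proof (induction l)
  case 0
  have "Pi\<^sub>E {0..0::nat} T_range = {\<lambda>x\<in>{0}. 0}"
    by (auto simp: T_range_def PiE_def extensional_def fun_eq_iff)
  then show ?case by (simp add: Y_def W'_def)
next
  case (Suc l)
  have "{0..Suc l} = insert (Suc l) {0..l}" by auto
  with Suc show ?case
    using expansion_step[of l _ f] by (simp add: sum_PiE_insert del: q_num.simps)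
qed

text \<open>After m stages the emptiness of the next \<open>M_set\<close> says that no remaining
  letter meets the last variable, so the whole product of variables and Y can be pulled out.\<close>

lemma expansion:
  "ddiff_word (W 1 r) (var_prod (i r - 1) * f) =
    (\<Sum>t\<in>Pi\<^sub>E {0..m} T_range. var_prod (i r - m - 1) * Y m t * ddiff_word (W' t 1 r) f)"
proof -
  have qm: "q m \<le> r" using q_le by simp
  have letters: "1 \<le> k \<and> k \<noteq> i r - 1 - m \<and> k < q m" if k: "k \<in> set (W 1 (q m))" for k
  proof -
    obtain j where j: "1 \<le> j" "j < q m" "k \<in> {i j..j}" using set_W[OF k] by blast
    moreover have "i r - Suc m \<notin> {i j..j}" using M_set_m j by (auto simp: M_set_def)
    moreover have "1 \<le> i j" using i_pos[of j] j qm by simp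
    ultimately show ?thesis by auto
  qed
  have "ddiff_word (W 1 (q m)) (var_prod (i r - 1 - m) * (Y m t * ddiff_word (W' t (q m) r) f)) =
      var_prod (i r - m - 1) * Y m t * ddiff_word (W' t 1 r) f" for t
  proof -
    have "W' t 1 (q m) = W 1 (q m)"
      using q_mono[of _ m] by (intro W'_eq_W) (auto simp: not_less)
    moreover have "W' t 1 r = W' t 1 (q m) @ W' t (q m) r"
    proof (cases "1 \<le> q m")
      case True
      then show ?thesis using W'_append qm by blast
    next
      case False
      \<comment> \<open>All later values of q are at least 1, so \<open>q m\<close> can vanish only
        as \<open>q 0\<close>; then r = 0 and the words are empty.\<close>
      then have "m = 0" using q_Suc(1)[of "m - 1"] by (cases m) (auto simp del: q_num.simps)
      with False show ?thesis by (simp add: W'_def)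
    qed
    ultimately show ?thesis
      using letters
      by (subst ddiff_word_mult_sym[OF swap_vars_var_prod], simp, simp)
        (subst ddiff_word_mult_sym[OF swap_vars_Y], simp_all add: mult.assoc)
  qed
  then show ?thesis using expansion_upto[of m f] by simp
qed

lemma PiE_T_range:
  "Pi\<^sub>E {0..m} T_range =
    {t \<in> extensional {0..m}. t 0 = 0 \<and> (\<forall>j\<in>{1..m}. i r - j \<le> t j \<and> t j \<le> q j + 1)}"
proof (intro set_eqI iffI)
  fix t assume t: "t \<in> Pi\<^sub>E {0..m} T_range"
  then have "t j \<in> T_range j" if "j \<le> m" for j using that by auto
  from this[of 0] this show "t \<in> {t \<in> extensional {0..m}. t 0 = 0 \<and>
      (\<forall>j\<in>{1..m}. i r - j \<le> t j \<and> t j \<le> q j + 1)}"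
    using t by (force simp: T_range_def PiE_def)
qed (auto simp: T_range_def PiE_def)

end

section \<open>Transfer of the expansion to one step of the recursion\<close>

lemma expansion_nf:
  assumes "v permutes {1..Suc n}"
  shows "expansion (nf (Suc n) v) n"
  using nf_correct(1)[OF assms] by unfold_locales (auto simp: valid_def)

lemma finite_T_vectors:
  assumes "v permutes {1..Suc n}"
  shows "finite (T_vectors (Suc n) v)"
proof -
  interpret expansion "nf (Suc n) v" n using expansion_nf[OF assms] .
  have "finite (Pi\<^sub>E {0..m} T_range)"
    by (intro finite_PiE) (auto simp: T_range_def)
  then show ?thesis
    unfolding PiE_T_range by (simp add: T_vectors_def Let_def)
qed

lemma set_step_word:
  assumes "v permutes {1..Suc n}"
  shows "set (step_word (Suc n) v t) \<subseteq> {1..<n}"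
proof
  interpret expansion "nf (Suc n) v" n using expansion_nf[OF assms] .
  fix k assume "k \<in> set (step_word (Suc n) v t)"
  then have "k \<in> set (W' t 1 n)"
    by (simp add: step_word_def W'_def Let_def blk_def[abs_def])
  then obtain j where "1 \<le> j" "j < n" "k \<in> {nf (Suc n) v j..j}" using set_W' by blast
  then show "k \<in> {1..<n}" using i_pos[of j] by auto
qed

lemma ddiff_schubert_w0_step:
  assumes "v permutes {1..Suc n}" "1 \<le> n"
  shows "ddiff_word (nf_word (Suc n) (nf (Suc n) v)) (schubert_w0 (Suc n)) =
    (\<Sum>t\<in>T_vectors (Suc n) v. X_mon (Suc n) v t * ddiff_word (step_word (Suc n) v t) (schubert_w0 n))"
proof -
  interpret expansion "nf (Suc n) v" n using expansion_nf[OF assms(1)] .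
  let ?i = "nf (Suc n) v"
  have i: "1 \<le> ?i n" "?i n \<le> Suc n"
    using nf_correct(1)[OF assms(1)] assms(2) by (auto simp: valid_Suc)
  have "ddiff_word (s_word n (?i n)) (schubert_w0 (Suc n)) = var_prod (?i n - 1) * schubert_w0 n"
    using ddiff_s_word_schubert_w0[of "?i n - 1" n] i by simp
  moreover have "nf_word n ?i = W 1 n" by (simp add: nf_word_def W_def)
  ultimately have "ddiff_word (nf_word (Suc n) ?i) (schubert_w0 (Suc n)) =
      ddiff_word (W 1 n) (var_prod (?i n - 1) * schubert_w0 n)"
    using assms(2) by (simp add: nf_word_Suc)
  also have "\<dots> = (\<Sum>t\<in>Pi\<^sub>E {0..m} T_range. var_prod (?i n - m - 1) * Y m t *
      ddiff_word (W' t 1 n) (schubert_w0 n))"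
    by (rule expansion)
  also have "\<dots> = (\<Sum>t\<in>T_vectors (Suc n) v. X_mon (Suc n) v t *
      ddiff_word (step_word (Suc n) v t) (schubert_w0 n))"
  proof (rule sum.cong)
    show "Pi\<^sub>E {0..m} T_range = T_vectors (Suc n) v"
      unfolding PiE_T_range by (simp add: T_vectors_def Let_def)
    fix t
    have "X_mon (Suc n) v t = var_prod (?i n - m - 1) * Y m t"
      by (simp add: X_mon_def Let_def var_prod_def Y_def)
    moreover have "step_word (Suc n) v t = W' t 1 n"
      by (simp add: step_word_def Let_def W'_def blk_def[abs_def])
    ultimately show "var_prod (?i n - m - 1) * Y m t * ddiff_word (W' t 1 n) (schubert_w0 n) =
        X_mon (Suc n) v t * ddiff_word (step_word (Suc n) v t) (schubert_w0 n)"
      by simp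
  qed
  finally show ?thesis .
qed


section \<open>Iteration\<close>

lemma step_permutes:
  assumes "v permutes {1..Suc n}" "step (Suc n) v t = Some v'"
  shows "v' permutes {1..n}"
  using assms perm_of_permutes[OF set_step_word[OF assms(1)]]
  by (auto simp: step_def split: if_splits)

section \<open>Splitting off the first vector of a sequence\<close>

definition step_vectors :: "nat \<Rightarrow> (nat \<Rightarrow> nat) \<Rightarrow> (nat \<Rightarrow> nat) set" where
  "step_vectors n u = {t \<in> T_vectors n u. step n u t \<noteq> None}"

lemma T_sequences_Suc:
  assumes "1 \<le> n"
  shows "T_sequences (Suc n) u =
    (\<Union>t\<in>step_vectors (Suc n) u. (#) t ` T_sequences n (the (step (Suc n) u t)))"
proof -
  have Cons: "t # ts \<in> T_sequences (Suc n) u \<longleftrightarrow>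
      t \<in> step_vectors (Suc n) u \<and> ts \<in> T_sequences n (the (step (Suc n) u t))" for t ts
  proof -
    have "(\<forall>l\<in>{1..n}. steps (Suc n) u (take (Suc n - l) (t # ts)) \<noteq> None) \<longleftrightarrow>
        t \<in> step_vectors (Suc n) u \<and>
        (\<forall>l\<in>{1..n}. steps n (the (step (Suc n) u t)) (take (n - l) ts) \<noteq> None)"
      using assms by (auto simp: Suc_diff_le step_vectors_def split: option.splits if_splits)
    \<comment> \<open>The index l = n leaves the empty prefix of the tail, for which
      \<open>steps\<close> is always defined; the other indices are those of the shorter
      sequence.\<close>
    moreover have "{1..n} = insert n {1..n - 1}" using assms by auto
    ultimately show ?thesis
      using assms by (auto simp: T_sequences_def)
  qed
  have "Ts \<noteq> []" if "Ts \<in> T_sequences (Suc n) u" for Ts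
    using that assms by (auto simp: T_sequences_def)
  then show ?thesis
    using Cons by (auto simp: image_iff) (metis neq_Nil_conv)
qed

definition T_weight :: "nat \<Rightarrow> (nat \<Rightarrow> nat) \<Rightarrow> (nat \<Rightarrow> nat) list \<Rightarrow> poly" where
  "T_weight n u Ts = (\<Prod>l = 1..n - 1.
    X_mon (l + 1) (the (steps n u (take (n - (l + 1)) Ts))) (Ts ! (n - 1 - l)))"

lemma T_weight_Cons:
  assumes "1 \<le> n" "t \<in> step_vectors (Suc n) u"
  shows "T_weight (Suc n) u (t # ts) =
    X_mon (Suc n) u t * T_weight n (the (step (Suc n) u t)) ts"
proof -
  obtain n' where n: "n = Suc n'" using assms(1) by (cases n) auto
  have "X_mon (l + 1) (the (steps (Suc n) u (take (Suc n - (l + 1)) (t # ts)))) ((t # ts) ! (n - l)) =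
      X_mon (l + 1) (the (steps n (the (step (Suc n) u t)) (take (n - (l + 1)) ts))) (ts ! (n - 1 - l))"
    if "l \<in> {1..n'}" for l
  proof -
    \<comment> \<open>Both the prefix length and the list position exceed 0 for l < n, so each loses
      exactly the leading vector t.\<close>
    have "Suc n - (l + 1) = Suc (n - (l + 1))" "n - l = Suc (n - 1 - l)"
      using that n by auto
    with assms(2) show ?thesis by (auto simp: step_vectors_def)
  qed
  then show ?thesis
    by (simp add: T_weight_def n mult.commute)
qed

lemma T_sequences_1: "T_sequences (Suc 0) u = {[]}"
  by (auto simp: T_sequences_def)

text \<open>Allows the sum over all sequences to be regrouped by the first vector.\<close>

lemma finite_T_sequences:
  assumes "1 \<le> n" "u permutes {1..n}"
  shows "finite (T_sequences n u)"
  using assms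
proof (induction n arbitrary: u rule: dec_induct)
  case base
  then show ?case by (simp add: T_sequences_1)
next
  case (step n)
  have "finite (step_vectors (Suc n) u)"
    using finite_T_vectors[OF step.prems] by (simp add: step_vectors_def)
  moreover have "finite (T_sequences n (the (step (Suc n) u t)))" if "t \<in> step_vectors (Suc n) u" for t
    using that step.IH step_permutes[OF step.prems] by (auto simp: step_vectors_def)
  ultimately show ?case
    using step.hyps by (auto simp: T_sequences_Suc)
qed

lemma ddiff_word_schubert_w0_eq_sum:
  assumes "1 \<le> n" "u permutes {1..n}"
  shows "ddiff_word (nf_word n (nf n u)) (schubert_w0 n) = (\<Sum>Ts\<in>T_sequences n u. T_weight n u Ts)"
  using assms
proof (induction n arbitrary: u rule: dec_induct)
  case base
  then show ?case by (simp add: T_sequences_1 T_weight_def schubert_w0_def)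
next
  case (step n)
  let ?v = "\<lambda>t. the (step (Suc n) u t)"
  note u = step.prems
  have "ddiff_word (nf_word (Suc n) (nf (Suc n) u)) (schubert_w0 (Suc n)) =
      (\<Sum>t\<in>T_vectors (Suc n) u. X_mon (Suc n) u t * ddiff_word (step_word (Suc n) u t) (schubert_w0 n))"
    using step by (intro ddiff_schubert_w0_step) auto
  also have "\<dots> = (\<Sum>t\<in>step_vectors (Suc n) u.
      X_mon (Suc n) u t * ddiff_word (step_word (Suc n) u t) (schubert_w0 n))"
    \<comment> \<open>The discarded vectors give words that are not reduced, whose divided
      differences vanish.\<close>
    by (rule sum.mono_neutral_right)
      (use finite_T_vectors[OF u] ddiff_word_not_reduced[OF set_step_word[OF u]]
        in \<open>auto simp: step_vectors_def step_def\<close>)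
  also have "\<dots> = (\<Sum>t\<in>step_vectors (Suc n) u. \<Sum>ts\<in>T_sequences n (?v t).
      T_weight (Suc n) u (t # ts))"
  proof (rule sum.cong)
    fix t assume t: "t \<in> step_vectors (Suc n) u"
    then have red: "reduced n (step_word (Suc n) u t)" and v: "?v t = perm_of (step_word (Suc n) u t)"
      by (auto simp: step_vectors_def step_def split: if_splits)
    have "?v t permutes {1..n}"
      using t step_permutes[OF u] by (auto simp: step_vectors_def)
    \<comment> \<open>A reduced step word acts like the normal form of its permutation, to which the
      induction hypothesis applies.\<close>
    then show "X_mon (Suc n) u t * ddiff_word (step_word (Suc n) u t) (schubert_w0 n) =
        (\<Sum>ts\<in>T_sequences n (?v t). T_weight (Suc n) u (t # ts))"
      using step.IH[of "?v t"] ddiff_word_nf[OF set_step_word[OF u] red] step.hyps t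
      by (simp add: T_weight_Cons sum_distrib_left v)
  qed simp
  also have "\<dots> = (\<Sum>t\<in>step_vectors (Suc n) u. \<Sum>Ts\<in>(#) t ` T_sequences n (?v t).
      T_weight (Suc n) u Ts)"
    by (simp add: sum.reindex)
  also have "\<dots> = (\<Sum>Ts\<in>T_sequences (Suc n) u. T_weight (Suc n) u Ts)"
    unfolding T_sequences_Suc[OF step.hyps(1)]
    \<comment> \<open>The pieces are disjoint because their lists have different heads.\<close>
    by (rule sum.UNION_disjoint[symmetric])
      (use finite_T_vectors[OF u] finite_T_sequences step.hyps step_permutes[OF u]
        in \<open>auto simp: step_vectors_def\<close>)
  finally show ?case .
qed

theorem theorem2:
  fixes n :: nat and u :: "nat \<Rightarrow> nat"
  assumes "n \<ge> 2" and "u permutes {1..n}"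
  shows "ddiff_word (nf_word n (nf n u)) (schubert_w0 n) =
    (\<Sum>Ts\<in>T_sequences n u. \<Prod>l = 1..n - 1.
       X_mon (l + 1) (the (steps n u (take (n - (l + 1)) Ts))) (Ts ! (n - 1 - l)))"
  using ddiff_word_schubert_w0_eq_sum[of n u] assms by (simp add: T_weight_def)


end
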